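(* Let $\mathcal{H}$ be a real Hilbert space, let $\alpha\in(0,\frac12)$, let $T:\mathcal{H}\to\mathcal{H}$ be an $\alpha$-averaged nonexpansive operator, and let $\hat{x}\in\mathrm{Fix}(T)$. For any given $x\in\mathcal{H}\setminus\mathrm{Fix}(T)$, define $$\theta^*:=\frac{-\langle Tx-x,\,Tx-\hat{x}\rangle}{\|Tx-x\|^2}.$$ Then $\theta^*>0$, and $\|T^{\theta}x-\hat{x}\|<\|Tx-\hat{x}\|$ for all $\theta\in(0,2\theta^* )$. Moreover, the function $\psi(\theta):=\|T^{\theta}x-\hat{x}\|$ is strictly decreasing on $[0,\theta^*]$.
   Context: $\mathcal{I}$ denotes the identity operator on $\mathcal{H}$, and $\mathrm{Fix}(T)=\{x\in\mathcal{H}: Tx=x\}$. An operator $\mathcal{N}:\mathcal{H}\to\mathcal{H}$ is nonexpansive if $\|\mathcal{N}x-\mathcal{N}y\|\le\|x-y\|$ for all $x,y\in\mathcal{H}$. For $\alpha\in(0,1)$, $T$ is $\alpha$-averaged nonexpansive if there is a nonexpansive $\mathcal{N}:\mathcal{H}\to\mathcal{H}$ with $T=(1-\alpha)\mathcal{I}+\alpha\mathcal{N}$. For $\theta\in\mathbb{R}$, $T^{\theta}:=T+\theta(T-\mathcal{I})$. *)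

theory Defs
  imports "HOL-Analysis.Analysis"
begin

definition Fix :: "('a \<Rightarrow> 'a) \<Rightarrow> 'a set"
  where "Fix T = {x. T x = x}"

definition nonexpansive :: "('a::real_normed_vector \<Rightarrow> 'a) \<Rightarrow> bool"
  where "nonexpansive N \<longleftrightarrow> (\<forall>x y. norm (N x - N y) \<le> norm (x - y))"

definition averaged_nonexpansive :: "real \<Rightarrow> ('a::real_normed_vector \<Rightarrow> 'a) \<Rightarrow> bool"
  where "averaged_nonexpansive \<alpha> T \<longleftrightarrow>
    0 < \<alpha> \<and> \<alpha> < 1 \<and>
    (\<exists>N. nonexpansive N \<and> T = (\<lambda>x. (1 - \<alpha>) *\<^sub>R x + \<alpha> *\<^sub>R N x))"

text \<open>The operator \<open>T + \<theta> (T - I)\<close>, written \<open>T\<close> with superscript \<open>\<theta>\<close> in informal notation.\<close>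

definition extrapolated :: "('a::real_vector \<Rightarrow> 'a) \<Rightarrow> real \<Rightarrow> 'a \<Rightarrow> 'a"
  where "extrapolated T \<theta> = (\<lambda>x. T x + \<theta> *\<^sub>R (T x - x))"

definition theta_star :: "('a::real_inner \<Rightarrow> 'a) \<Rightarrow> 'a \<Rightarrow> 'a \<Rightarrow> real"
  where "theta_star T xhat x = - ((T x - x) \<bullet> (T x - xhat)) / (norm (T x - x))\<^sup>2"

end

theory Submission
  imports Defs
begin

text \<open>
  Put \<open>d = T x - x\<close>. As \<open>\<theta>\<close> varies, \<open>extrapolated T \<theta> x\<close> runs along a line with direction \<open>d\<close>,
  and \<open>theta_star T xhat x\<close> is the parameter of the foot of the perpendicular from \<open>xhat\<close> to
  that line. Completing the square therefore shows that the distance to \<open>xhat\<close> is ordered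
  exactly as the distance of \<open>\<theta>\<close> to \<open>theta_star T xhat x\<close>
  (\<open>norm_extrapolated_less_iff\<close>). Both claims about the norm become comparisons of real numbers,
  since \<open>T x\<close> is the point with parameter \<open>0\<close>.

  The remaining claim, that the foot lies strictly beyond \<open>T x\<close>, is where \<open>\<alpha> < 1 / 2\<close> enters.
  Nonexpansiveness of \<open>N\<close> gives \<open>d \<bullet> (T x - xhat) \<le> (1 - 1 / (2 * \<alpha>)) * (norm d)\<^sup>2\<close>, and the
  coefficient on the right is negative precisely for \<open>\<alpha> < 1 / 2\<close>.
\<close>

text \<open>
  With \<open>u = x - z\<close> and \<open>w = N x - x\<close>, nonexpansiveness at the common fixed point \<open>z\<close> of \<open>T\<close>
  and \<open>N\<close> says that adding \<open>w\<close> to \<open>u\<close> does not lengthen it, so \<open>2 * (u \<bullet> w) \<le> - (w \<bullet> w)\<close>.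
  In terms of \<open>d = \<alpha> *\<^sub>R w\<close>, which is \<open>T x - x\<close>, this reads
  \<open>d \<bullet> u \<le> - (norm d)\<^sup>2 / (2 * \<alpha>)\<close>, and passing from \<open>u\<close> to \<open>T x - z = u + d\<close> adds one
  further \<open>(norm d)\<^sup>2\<close>.
\<close>

lemma averaged_nonexpansive_inner_le:
  fixes T :: "'a::real_inner \<Rightarrow> 'a"
  assumes avg: "averaged_nonexpansive \<alpha> T" and fixed: "z \<in> Fix T"
  shows "(T x - x) \<bullet> (T x - z) \<le> (1 - 1 / (2 * \<alpha>)) * (norm (T x - x))\<^sup>2"
proof -
  from avg obtain N where \<alpha>: "0 < \<alpha>" and N: "nonexpansive N"
    and T: "T = (\<lambda>x. (1 - \<alpha>) *\<^sub>R x + \<alpha> *\<^sub>R N x)"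
    unfolding averaged_nonexpansive_def by blast
  have "\<alpha> *\<^sub>R (N z - z) = 0"
    using fixed by (simp add: Fix_def T algebra_simps)
  then have Nz: "N z = z"
    using \<alpha> by simp
  define u where "u = x - z"
  define w where "w = N x - x"
  have "norm (u + w) \<le> norm u"
    using N[unfolded nonexpansive_def, rule_format, of x z] Nz by (simp add: u_def w_def)
  then have "(norm (u + w))\<^sup>2 \<le> (norm u)\<^sup>2"
    by simp
  then have "2 * (u \<bullet> w) + w \<bullet> w \<le> 0"
    by (simp add: power2_norm_eq_inner inner_add_left inner_add_right inner_commute)
  then have key: "\<alpha> * (2 * (u \<bullet> w) + w \<bullet> w) \<le> 0"
    using \<alpha> by (simp add: mult_le_0_iff)
  have d: "T x - x = \<alpha> *\<^sub>R w"
    by (simp add: T w_def algebra_simps)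
  then have v: "T x - z = u + \<alpha> *\<^sub>R w"
    by (simp add: u_def algebra_simps)
  have "(1 - 1 / (2 * \<alpha>)) * (norm (T x - x))\<^sup>2 = (\<alpha>\<^sup>2 - \<alpha> / 2) * (w \<bullet> w)"
    using \<alpha> unfolding d power2_norm_eq_inner by (simp add: field_simps power2_eq_square)
  moreover have "(T x - x) \<bullet> (T x - z) = \<alpha> * (u \<bullet> w) + \<alpha>\<^sup>2 * (w \<bullet> w)"
    unfolding d v by (simp add: inner_add_right inner_commute power2_eq_square algebra_simps)
  ultimately show ?thesis
    using key by (simp add: algebra_simps)
qed

lemma theta_star_pos:
  fixes T :: "'a::real_inner \<Rightarrow> 'a"
  assumes avg: "averaged_nonexpansive \<alpha> T" and half: "\<alpha> < 1 / 2"
    and "z \<in> Fix T" and "x \<notin> Fix T"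
  shows "theta_star T z x > 0"
proof -
  have "0 < \<alpha>"
    using avg by (simp add: averaged_nonexpansive_def)
  then have "1 - 1 / (2 * \<alpha>) < 0"
    using half by (simp add: field_simps)
  moreover have d: "0 < (norm (T x - x))\<^sup>2"
    using \<open>x \<notin> Fix T\<close> by (simp add: Fix_def)
  ultimately have "(T x - x) \<bullet> (T x - z) < 0"
    using averaged_nonexpansive_inner_le[OF avg \<open>z \<in> Fix T\<close>, of x]
    by (meson le_less_trans mult_neg_pos)
  then show ?thesis
    using d unfolding theta_star_def by (intro divide_pos_pos) auto
qed

text \<open>
  Pythagoras: the constant \<open>c\<close> in the proof is the squared distance from \<open>z\<close> to the line, and
  \<open>(norm (T x - x))\<^sup>2 * (\<theta> - theta_star T z x)\<^sup>2\<close> is the squared distance along the line from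
  the foot of the perpendicular.
\<close>

lemma norm_extrapolated_less_iff:
  fixes T :: "'a::real_inner \<Rightarrow> 'a"
  assumes "x \<notin> Fix T"
  shows "norm (extrapolated T \<theta> x - z) < norm (extrapolated T \<eta> x - z)
    \<longleftrightarrow> \<bar>\<theta> - theta_star T z x\<bar> < \<bar>\<eta> - theta_star T z x\<bar>"
proof -
  define d where "d = T x - x"
  define v where "v = T x - z"
  define s where "s = theta_star T z x"
  define c where "c = (norm v)\<^sup>2 - (norm d)\<^sup>2 * s\<^sup>2"
  have d: "0 < (norm d)\<^sup>2"
    using assms by (simp add: Fix_def d_def)
  then have s: "d \<bullet> v = - s * (norm d)\<^sup>2"
    by (simp add: s_def theta_star_def d_def v_def)
  have square: "(norm (extrapolated T t x - z))\<^sup>2 = c + (norm d)\<^sup>2 * (t - s)\<^sup>2" for t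
  proof -
    have "extrapolated T t x - z = v + t *\<^sub>R d"
      by (simp add: extrapolated_def d_def v_def)
    then have "(norm (extrapolated T t x - z))\<^sup>2 = (v + t *\<^sub>R d) \<bullet> (v + t *\<^sub>R d)"
      by (simp only: power2_norm_eq_inner)
    also have "\<dots> = (norm v)\<^sup>2 + 2 * t * (d \<bullet> v) + t\<^sup>2 * (norm d)\<^sup>2"
      unfolding power2_norm_eq_inner
      by (simp add: inner_add_left inner_add_right inner_commute power2_eq_square)
    finally show ?thesis
      unfolding s c_def by (simp add: power2_eq_square algebra_simps)
  qed
  have "norm (extrapolated T \<theta> x - z) < norm (extrapolated T \<eta> x - z)
      \<longleftrightarrow> (norm (extrapolated T \<theta> x - z))\<^sup>2 < (norm (extrapolated T \<eta> x - z))\<^sup>2"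
    by (simp flip: linorder_not_le)
  also have "\<dots> \<longleftrightarrow> (\<theta> - s)\<^sup>2 < (\<eta> - s)\<^sup>2"
    using d by (simp add: square)
  also have "\<dots> \<longleftrightarrow> \<bar>\<theta> - s\<bar> < \<bar>\<eta> - s\<bar>"
    by (metis abs_le_square_iff linorder_not_le)
  finally show ?thesis
    by (simp add: s_def)
qed

theorem theorem3p3:
  fixes T :: "'a::{real_inner, complete_space} \<Rightarrow> 'a"
    and \<alpha> :: real
    and xhat x :: 'a
  assumes "0 < \<alpha>" and "\<alpha> < 1 / 2"
    and "averaged_nonexpansive \<alpha> T"
    and "xhat \<in> Fix T"
    and "x \<notin> Fix T"
  shows "theta_star T xhat x > 0
    \<and> (\<forall>\<theta> \<in> {0 <..< 2 * theta_star T xhat x}.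
          norm (extrapolated T \<theta> x - xhat) < norm (T x - xhat))
    \<and> strict_antimono_on {0 .. theta_star T xhat x}
          (\<lambda>\<theta>. norm (extrapolated T \<theta> x - xhat))"
proof (intro conjI ballI)
  show "theta_star T xhat x > 0"
    using theta_star_pos assms by blast
next
  fix \<theta> assume "\<theta> \<in> {0 <..< 2 * theta_star T xhat x}"
  then have "norm (extrapolated T \<theta> x - xhat) < norm (extrapolated T 0 x - xhat)"
    unfolding norm_extrapolated_less_iff[OF \<open>x \<notin> Fix T\<close>] by auto
  then show "norm (extrapolated T \<theta> x - xhat) < norm (T x - xhat)"
    by (simp add: extrapolated_def)
next
  show "strict_antimono_on {0 .. theta_star T xhat x}
      (\<lambda>\<theta>. norm (extrapolated T \<theta> x - xhat))"
    by (rule monotone_onI) (auto simp: norm_extrapolated_less_iff[OF \<open>x \<notin> Fix T\<close>])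
qed

end
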